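(* For every $\mu\in S^1$ the map $$\Phi_\mu:\Lambda G_\tau\to G\ltimes\mathfrak g,\qquad \Phi_\mu(F)=\left.\left(F,\;F'F^{-1}\right)\right|_{\lambda=\mu}$$ is a group homomorphism, where, for $F\in\Lambda G_\tau$ and $\lambda=e^{it}$, $F'$ denotes the derivative of $F$ with respect to $t\in\mathbb R$.
   Context: $G$ is a compact semisimple Lie group with Lie algebra $\mathfrak g$, $\tau:G\to G$ is an automorphism of finite order $k\ge2$, $\omega=e^{2\pi i/k}$, and $\Lambda G_\tau=\{g:S^1\to G\text{ smooth}: g(\omega\lambda)=\tau g(\lambda)\}$ with pointwise multiplication. $G\ltimes\mathfrak g$ is the semi-direct product in which $G$ acts on $\mathfrak g$ by the adjoint action, i.e. $(g,\zeta)(h,\eta)=(gh,\ \mathrm{Ad}_g\,\eta+\zeta)$. *)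

theory Defs
  imports "HOL-Analysis.Analysis" "HOL-Algebra.Bij" "HOL-Algebra.Multiplicative_Group"
begin

section \<open>Smooth maps between open subsets of finite-dimensional spaces\<close>

text \<open>
  The iterated directional derivatives of order below \<open>n\<close> are differentiable and those of order \<open>n\<close>
  are continuous. On an open subset of a finite-dimensional space this is the usual notion of a map
  of class $C^n$; it is only used for such sets.
\<close>

primrec Ck_on :: "nat \<Rightarrow> 'a set \<Rightarrow> ('a::real_normed_vector \<Rightarrow> 'b::real_normed_vector) \<Rightarrow> bool" where
  "Ck_on 0 S f \<longleftrightarrow> continuous_on S f"
| "Ck_on (Suc n) S f \<longleftrightarrow>
     (\<forall>x\<in>S. f differentiable (at x)) \<and> (\<forall>v. Ck_on n S (\<lambda>x. frechet_derivative f (at x) v))"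

definition smooth_on :: "'a set \<Rightarrow> ('a::real_normed_vector \<Rightarrow> 'b::real_normed_vector) \<Rightarrow> bool" where
  "smooth_on S f \<longleftrightarrow> (\<forall>n. Ck_on n S f)"


section \<open>Smooth manifolds\<close>

text \<open>
  A chart is a pair of its domain and its coordinate map. The coordinate space is a
  finite-dimensional inner product space; the class \<open>euclidean_space\<close> is not used because it
  excludes dimension 0, and hence finite groups. Atlases need not be maximal. Functions on a
  manifold are total HOL functions of which only the values on the underlying space matter.
\<close>

record ('p, 'e) manifold =
  mtop :: "'p topology"
  atlas :: "('p set \<times> ('p \<Rightarrow> 'e)) set"

definition smooth_manifold :: "('p, 'e::real_inner) manifold \<Rightarrow> bool" where
  "smooth_manifold M \<longleftrightarrow>
     (\<exists>B::'e set. finite B \<and> span B = UNIV) \<and>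
     Hausdorff_space (mtop M) \<and> second_countable (mtop M) \<and>
     \<Union>(fst ` atlas M) = topspace (mtop M) \<and>
     (\<forall>(U, \<phi>) \<in> atlas M. openin (mtop M) U \<and> open (\<phi> ` U) \<and>
        homeomorphic_map (subtopology (mtop M) U) (top_of_set (\<phi> ` U)) \<phi>) \<and>
     (\<forall>(U, \<phi>) \<in> atlas M. \<forall>(V, \<psi>) \<in> atlas M. smooth_on (\<phi> ` (U \<inter> V)) (\<psi> \<circ> inv_into U \<phi>))"

definition smooth_map ::
  "('p, 'e::real_inner) manifold \<Rightarrow> ('q, 'f::real_inner) manifold \<Rightarrow> ('p \<Rightarrow> 'q) \<Rightarrow> bool" where
  "smooth_map M N F \<longleftrightarrow>
     continuous_map (mtop M) (mtop N) F \<and>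
     (\<forall>(U, \<phi>) \<in> atlas M. \<forall>(V, \<psi>) \<in> atlas N.
        smooth_on (\<phi> ` (U \<inter> F -` V)) (\<psi> \<circ> F \<circ> inv_into U \<phi>))"

definition real_line :: "(real, real) manifold" where
  "real_line = \<lparr>mtop = euclidean, atlas = {(UNIV, \<lambda>x. x)}\<rparr>"

definition prod_manifold ::
  "('p, 'e) manifold \<Rightarrow> ('q, 'f) manifold \<Rightarrow> ('p \<times> 'q, 'e \<times> 'f) manifold" where
  "prod_manifold M N =
     \<lparr>mtop = prod_topology (mtop M) (mtop N),
      atlas = {(U \<times> V, map_prod \<phi> \<psi>) | U \<phi> V \<psi>. (U, \<phi>) \<in> atlas M \<and> (V, \<psi>) \<in> atlas N}\<rparr>"

definition smooth_funs :: "('p, 'e::real_inner) manifold \<Rightarrow> ('p \<Rightarrow> real) set" where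
  "smooth_funs M = {f. smooth_map M real_line f}"


section \<open>Tangent vectors\<close>

text \<open>
  Tangent vectors at \<open>p\<close> are the derivations at \<open>p\<close> of the algebra of smooth functions, extended
  by 0 to non-smooth functions so that equality of tangent vectors is equality of functionals.
  A derivation at \<open>p\<close> automatically ignores the values of a function outside the manifold: if \<open>h\<close>
  vanishes on the manifold and \<open>\<chi>\<close> is the indicator function of its complement, then
  \<open>h = h \<cdot> \<chi>\<close>, and the Leibniz rule gives \<open>X h = h p * X \<chi> + \<chi> p * X h = 0\<close>.
\<close>

type_synonym 'p functional = "('p \<Rightarrow> real) \<Rightarrow> real"

definition tangent_space :: "('p, 'e::real_inner) manifold \<Rightarrow> 'p \<Rightarrow> 'p functional set" where
  "tangent_space M p =
     {X. (\<forall>f\<in>smooth_funs M. \<forall>g\<in>smooth_funs M. X (\<lambda>x. f x + g x) = X f + X g) \<and>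
         (\<forall>c. \<forall>f\<in>smooth_funs M. X (\<lambda>x. c * f x) = c * X f) \<and>
         (\<forall>f\<in>smooth_funs M. \<forall>g\<in>smooth_funs M. X (\<lambda>x. f x * g x) = f p * X g + g p * X f) \<and>
         (\<forall>f. f \<notin> smooth_funs M \<longrightarrow> X f = 0)}"

text \<open>The differential of a smooth map from \<open>M\<close> to \<open>N\<close>, applied to a tangent vector of \<open>M\<close>.\<close>

definition differential ::
  "('q, 'f::real_inner) manifold \<Rightarrow> ('p \<Rightarrow> 'q) \<Rightarrow> 'p functional \<Rightarrow> 'q functional" where
  "differential N F X = (\<lambda>f. if f \<in> smooth_funs N then X (f \<circ> F) else 0)"

definition velocity ::
  "('p, 'e::real_inner) manifold \<Rightarrow> (real \<Rightarrow> 'p) \<Rightarrow> real \<Rightarrow> 'p functional" where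
  "velocity M \<gamma> t = (\<lambda>f. if f \<in> smooth_funs M then deriv (\<lambda>s. f (\<gamma> s)) t else 0)"

text \<open>Vector space operations; all tangent spaces are closed under them.\<close>

definition vec_zero :: "'p functional" where
  "vec_zero = (\<lambda>f. 0)"

definition vec_add :: "'p functional \<Rightarrow> 'p functional \<Rightarrow> 'p functional" where
  "vec_add X Y = (\<lambda>f. X f + Y f)"

definition vec_scale :: "real \<Rightarrow> 'p functional \<Rightarrow> 'p functional" where
  "vec_scale c X = (\<lambda>f. c * X f)"

definition vec_subspace :: "'p functional set \<Rightarrow> bool" where
  "vec_subspace V \<longleftrightarrow>
     vec_zero \<in> V \<and> (\<forall>X\<in>V. \<forall>Y\<in>V. vec_add X Y \<in> V) \<and> (\<forall>c. \<forall>X\<in>V. vec_scale c X \<in> V)"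


section \<open>Lie groups and their Lie algebras\<close>

locale lie_group = group G
  for G :: "('g, 'b) monoid_scheme" (structure) and M :: "('g, 'e::real_inner) manifold" +
  assumes manifold: "smooth_manifold M"
    and carrier_eq: "carrier G = topspace (mtop M)"
    and smooth_mult: "smooth_map (prod_manifold M M) M (\<lambda>(x, y). x \<otimes> y)"
    and smooth_inv: "smooth_map M M (\<lambda>x. inv x)"

definition lie_algebra ::
  "('g, 'b) monoid_scheme \<Rightarrow> ('g, 'e::real_inner) manifold \<Rightarrow> 'g functional set" where
  "lie_algebra G M = tangent_space M \<one>\<^bsub>G\<^esub>"

text \<open>The derivative of \<open>f\<close> along the left-invariant vector field with value \<open>X\<close> at the identity.\<close>

definition left_inv_field ::
  "('g, 'b) monoid_scheme \<Rightarrow> 'g functional \<Rightarrow> ('g \<Rightarrow> real) \<Rightarrow> 'g \<Rightarrow> real" where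
  "left_inv_field G X f = (\<lambda>g. X (\<lambda>h. f (g \<otimes>\<^bsub>G\<^esub> h)))"

text \<open>The value at the identity of the commutator of the left-invariant vector fields.\<close>

definition lie_bracket ::
  "('g, 'b) monoid_scheme \<Rightarrow> ('g, 'e::real_inner) manifold \<Rightarrow>
     'g functional \<Rightarrow> 'g functional \<Rightarrow> 'g functional" where
  "lie_bracket G M X Y =
     (\<lambda>f. if f \<in> smooth_funs M
          then X (left_inv_field G Y f) - Y (left_inv_field G X f) else 0)"

definition lie_ideal ::
  "('g, 'b) monoid_scheme \<Rightarrow> ('g, 'e::real_inner) manifold \<Rightarrow> 'g functional set \<Rightarrow> bool" where
  "lie_ideal G M I \<longleftrightarrow>
     I \<subseteq> lie_algebra G M \<and> vec_subspace I \<and>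
     (\<forall>X\<in>lie_algebra G M. \<forall>Y\<in>I. lie_bracket G M X Y \<in> I)"

definition derived_algebra ::
  "('g, 'b) monoid_scheme \<Rightarrow> ('g, 'e::real_inner) manifold \<Rightarrow>
     'g functional set \<Rightarrow> 'g functional set" where
  "derived_algebra G M H =
     \<Inter>{W. vec_subspace W \<and> (\<forall>X\<in>H. \<forall>Y\<in>H. lie_bracket G M X Y \<in> W)}"

definition lie_solvable ::
  "('g, 'b) monoid_scheme \<Rightarrow> ('g, 'e::real_inner) manifold \<Rightarrow> 'g functional set \<Rightarrow> bool" where
  "lie_solvable G M H \<longleftrightarrow> (\<exists>n. (derived_algebra G M ^^ n) H = {vec_zero})"

definition semisimple ::
  "('g, 'b) monoid_scheme \<Rightarrow> ('g, 'e::real_inner) manifold \<Rightarrow> bool" where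
  "semisimple G M \<longleftrightarrow> (\<forall>I. lie_ideal G M I \<and> lie_solvable G M I \<longrightarrow> I = {vec_zero})"

text \<open>As elements of \<open>auto G\<close>, automorphisms are extensional functions on the carrier.\<close>

definition lie_auto ::
  "('g, 'b) monoid_scheme \<Rightarrow> ('g, 'e::real_inner) manifold \<Rightarrow> ('g \<Rightarrow> 'g) set" where
  "lie_auto G M =
     {\<tau> \<in> auto G. smooth_map M M \<tau> \<and> smooth_map M M (inv_into (carrier G) \<tau>)}"

definition Ad ::
  "('g, 'b) monoid_scheme \<Rightarrow> ('g, 'e::real_inner) manifold \<Rightarrow>
     'g \<Rightarrow> 'g functional \<Rightarrow> 'g functional" where
  "Ad G M g = differential M (\<lambda>x. g \<otimes>\<^bsub>G\<^esub> x \<otimes>\<^bsub>G\<^esub> inv\<^bsub>G\<^esub> g)"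

definition semidirect ::
  "('g, 'b) monoid_scheme \<Rightarrow> ('g, 'e::real_inner) manifold \<Rightarrow> ('g \<times> 'g functional) monoid" where
  "semidirect G M =
     \<lparr>carrier = carrier G \<times> lie_algebra G M,
      mult = (\<lambda>(g, \<zeta>) (h, \<eta>). (g \<otimes>\<^bsub>G\<^esub> h, vec_add (Ad G M g \<eta>) \<zeta>)),
      one = (\<one>\<^bsub>G\<^esub>, vec_zero)\<rparr>"


section \<open>Twisted loop groups\<close>

text \<open>
  Loops are extensional functions on the unit circle. The smooth structure of the circle is the one
  for which \<open>cis\<close> (the map from \<open>t\<close> to $e^{it}$) is a local diffeomorphism, so a loop \<open>F\<close> is
  smooth iff \<open>F (cis t)\<close> depends smoothly on the real number \<open>t\<close>.
\<close>

definition twisted_loop_group ::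
  "('g, 'b) monoid_scheme \<Rightarrow> ('g, 'e::real_inner) manifold \<Rightarrow> ('g \<Rightarrow> 'g) \<Rightarrow> nat \<Rightarrow>
     (complex \<Rightarrow> 'g) monoid" where
  "twisted_loop_group G M \<tau> k =
     \<lparr>carrier = {F \<in> sphere 0 1 \<rightarrow>\<^sub>E carrier G.
         smooth_map real_line M (\<lambda>t. F (cis t)) \<and>
         (\<forall>z\<in>sphere 0 1. F (exp (2 * complex_of_real pi * \<i> / of_nat k) * z) = \<tau> (F z))},
      mult = (\<lambda>F H. \<lambda>z\<in>sphere 0 1. F z \<otimes>\<^bsub>G\<^esub> H z),
      one = (\<lambda>z\<in>sphere 0 1. \<one>\<^bsub>G\<^esub>)\<rparr>"

text \<open>
  $F' F^{-1}$ at $\lambda = \mu$: the velocity of \<open>F (cis t)\<close>, a tangent vector at \<open>F \<mu>\<close>, is moved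
  to the identity by the right translation with the inverse of \<open>F \<mu>\<close>. By periodicity, any other
  \<open>t\<close> with \<open>cis t = \<mu>\<close> in place of \<open>Arg \<mu>\<close> gives the same vector.
\<close>

definition right_log_deriv ::
  "('g, 'b) monoid_scheme \<Rightarrow> ('g, 'e::real_inner) manifold \<Rightarrow> complex \<Rightarrow>
     (complex \<Rightarrow> 'g) \<Rightarrow> 'g functional" where
  "right_log_deriv G M \<mu> F =
     differential M (\<lambda>x. x \<otimes>\<^bsub>G\<^esub> inv\<^bsub>G\<^esub> (F \<mu>)) (velocity M (\<lambda>t. F (cis t)) (Arg \<mu>))"

definition Phi ::
  "('g, 'b) monoid_scheme \<Rightarrow> ('g, 'e::real_inner) manifold \<Rightarrow> complex \<Rightarrow>
     (complex \<Rightarrow> 'g) \<Rightarrow> 'g \<times> 'g functional" where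
  "Phi G M \<mu> F = (F \<mu>, right_log_deriv G M \<mu> F)"

end

theory Submission
  imports Defs
begin

text \<open>
  Evaluation at \<open>\<mu>\<close> is multiplicative by the definition of the pointwise product, so the content of
  the homomorphism property lies in the second component. Writing \<open>\<gamma>\<close> and \<open>\<delta>\<close> for two loops as
  functions of \<open>t\<close>, the product rule gives
  \<open>(\<gamma> \<delta>)' (\<gamma> \<delta>)\<^sup>-\<^sup>1 = \<gamma>' \<gamma>\<^sup>-\<^sup>1 + \<gamma> (\<delta>' \<delta>\<^sup>-\<^sup>1) \<gamma>\<^sup>-\<^sup>1\<close>, and the last summand is
  \<open>Ad \<gamma> (\<delta>' \<delta>\<^sup>-\<^sup>1)\<close>: this is precisely the multiplication of the semi-direct product
  (\<open>log_velocity_mult\<close>).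

  Since tangent vectors are derivations of the smooth functions, the product rule on the group
  becomes a statement about real functions. For a smooth function \<open>f\<close> on the group,
  \<open>f (\<gamma> s \<otimes> \<delta> u)\<close> is a differentiable function of two real variables, and its derivative along the
  diagonal is the sum of its two partial derivatives (\<open>deriv_diagonal\<close>, \<open>velocity_mult\<close>). Left and
  right translations enter only through the functoriality of the differential.

  What has to be built for this is the smoothness of composites of smooth maps between manifolds,
  which rests on the chain rule for maps of class $C^n$ (\<open>Ck_on_compose\<close>, \<open>smooth_map_compose\<close>). It
  yields the smoothness of pointwise products and inverses of loops, so that loops form a group, the
  fact that differentials map tangent vectors to tangent vectors, so that the adjoint action
  preserves the Lie algebra and the semi-direct product is a group, and the smoothness of
  \<open>f (\<gamma> s \<otimes> \<delta> u)\<close> above.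
\<close>

section \<open>Calculus of maps of class $C^n$\<close>

lemma Ck_on_subset: "Ck_on n S f \<Longrightarrow> T \<subseteq> S \<Longrightarrow> Ck_on n T f"
  by (induction n arbitrary: f) (auto intro: continuous_on_subset)

lemma Ck_on_cong:
  assumes "open S" "\<And>x. x \<in> S \<Longrightarrow> f x = g x" "Ck_on n S f"
  shows "Ck_on n S g"
  using assms(2,3)
proof (induction n arbitrary: f g)
  case 0
  then show ?case
    by (metis Ck_on.simps(1) continuous_on_cong)
next
  case (Suc n)
  have D: "(g has_derivative frechet_derivative f (at x)) (at x)" if "x \<in> S" for x
  proof -
    have "(f has_derivative frechet_derivative f (at x)) (at x)"
      using Suc.prems(2) that by (simp add: frechet_derivative_works)
    then show ?thesis
      using has_derivative_transform_within_open[OF _ \<open>open S\<close> that] Suc.prems(1) by blast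
  qed
  have eq: "frechet_derivative f (at x) = frechet_derivative g (at x)" if "x \<in> S" for x
    using frechet_derivative_at[OF D[OF that]] .
  have "Ck_on n S (\<lambda>x. frechet_derivative g (at x) v)" for v
    using Suc.IH[of "\<lambda>x. frechet_derivative f (at x) v" "\<lambda>x. frechet_derivative g (at x) v"]
      Suc.prems(2) eq by auto
  then show ?case
    using D by (auto simp: differentiable_def)
qed

text \<open>
  Introduces the next order of differentiability from a family of derivatives given by any formula,
  which is how the calculus rules of the library deliver them.
\<close>

lemma Ck_on_SucI:
  assumes "open S" "\<And>x. x \<in> S \<Longrightarrow> (f has_derivative D x) (at x)"
    and "\<And>v. Ck_on n S (\<lambda>x. D x v)"
  shows "Ck_on (Suc n) S f"
proof -
  have "D x v = frechet_derivative f (at x) v" if "x \<in> S" for x v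
    using frechet_derivative_at[OF assms(2)[OF that]] by simp
  then have "Ck_on n S (\<lambda>x. frechet_derivative f (at x) v)" for v
    by (intro Ck_on_cong[OF assms(1) _ assms(3)[of v]]) auto
  then show ?thesis
    using assms(2) by (auto simp: differentiable_def)
qed

lemma Ck_on_SucD:
  assumes "Ck_on (Suc n) S f"
  shows "x \<in> S \<Longrightarrow> (f has_derivative frechet_derivative f (at x)) (at x)"
    and "Ck_on n S (\<lambda>x. frechet_derivative f (at x) v)"
  using assms by (auto simp: frechet_derivative_works)

lemma Ck_on_Suc_imp: "Ck_on (Suc n) S f \<Longrightarrow> Ck_on n S f"
proof (induction n arbitrary: f)
  case 0
  then show ?case
    by (auto intro!: continuous_at_imp_continuous_on differentiable_imp_continuous_within)
next
  case (Suc n)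
  show ?case
    by (subst Ck_on.simps(2)) (use Suc.prems Suc.IH in auto)
qed

text \<open>
  Composites are studied near one point at a time, since a single chart of the middle manifold need
  not contain the whole image of a chart domain.
\<close>

lemma Ck_on_local:
  assumes "\<And>x. x \<in> S \<Longrightarrow> \<exists>T. open T \<and> x \<in> T \<and> Ck_on n T f"
  shows "Ck_on n S f"
  using assms
proof (induction n arbitrary: f)
  case 0
  show ?case
    unfolding Ck_on.simps
  proof (rule continuous_at_imp_continuous_on, rule ballI)
    fix x assume "x \<in> S"
    then obtain T where "open T" "x \<in> T" "continuous_on T f"
      using 0[OF \<open>x \<in> S\<close>] by auto
    then show "isCont f x"
      by (simp add: continuous_on_eq_continuous_at)
  qed
next
  case (Suc n)
  have "f differentiable (at x)" if "x \<in> S" for x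
    using Suc.prems[OF that] by auto
  moreover have "Ck_on n S (\<lambda>x. frechet_derivative f (at x) v)" for v
  proof (rule Suc.IH)
    fix x assume "x \<in> S"
    then show "\<exists>T. open T \<and> x \<in> T \<and> Ck_on n T (\<lambda>x. frechet_derivative f (at x) v)"
      using Suc.prems[of x] by auto
  qed
  ultimately show ?case by simp
qed

lemma Ck_on_const: "open S \<Longrightarrow> Ck_on n S (\<lambda>x. c)"
proof (induction n arbitrary: c)
  case (Suc n)
  show ?case
    by (rule Ck_on_SucI[OF \<open>open S\<close>, of _ "\<lambda>x v. 0"])
      (use Suc in \<open>auto intro: derivative_eq_intros\<close>)
qed auto

lemma Ck_on_bounded_linear:
  assumes "open S" "bounded_linear f"
  shows "Ck_on n S f"
proof (cases n)
  case 0
  then show ?thesis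
    using assms(2) by (simp add: linear_continuous_on)
next
  case (Suc m)
  show ?thesis
    unfolding Suc
    by (rule Ck_on_SucI[OF \<open>open S\<close>, of _ "\<lambda>x. f"])
      (use assms in \<open>auto intro: bounded_linear_imp_has_derivative Ck_on_const\<close>)
qed

lemma Ck_on_add:
  assumes "open S" "Ck_on n S f" "Ck_on n S g"
  shows "Ck_on n S (\<lambda>x. f x + g x)"
  using assms(2,3)
proof (induction n arbitrary: f g)
  case 0
  then show ?case by (auto intro: continuous_on_add)
next
  case (Suc n)
  note f = Ck_on_SucD[OF Suc.prems(1)] and g = Ck_on_SucD[OF Suc.prems(2)]
  show ?case
    by (rule Ck_on_SucI[OF \<open>open S\<close>]) (rule has_derivative_add f g Suc.IH | assumption)+
qed

lemma Ck_on_sum: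
  assumes "open S" "finite I" "\<And>i. i \<in> I \<Longrightarrow> Ck_on n S (f i)"
  shows "Ck_on n S (\<lambda>x. \<Sum>i\<in>I. f i x)"
  using assms(2,3)
  by (induction I rule: finite_induct) (auto intro: Ck_on_add Ck_on_const \<open>open S\<close>)

lemma Ck_on_bilinear:
  assumes "bounded_bilinear p" "open S" "Ck_on n S f" "Ck_on n S g"
  shows "Ck_on n S (\<lambda>x. p (f x) (g x))"
  using assms(3,4)
proof (induction n arbitrary: f g)
  case 0
  then show ?case by (auto intro: bounded_bilinear.continuous_on[OF assms(1)])
next
  case (Suc n)
  note f = Ck_on_SucD[OF Suc.prems(1)] and g = Ck_on_SucD[OF Suc.prems(2)]
  show ?case
    by (rule Ck_on_SucI[OF \<open>open S\<close>])
      (rule bounded_bilinear.FDERIV[OF assms(1)] f g Ck_on_add \<open>open S\<close> Suc.IH Suc.prems[THEN Ck_on_Suc_imp] | assumption)+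
qed

lemma Ck_on_Pair:
  assumes "open S" "Ck_on n S f" "Ck_on n S g"
  shows "Ck_on n S (\<lambda>x. (f x, g x))"
  using assms(2,3)
proof (induction n arbitrary: f g)
  case 0
  then show ?case by (auto intro: continuous_on_Pair)
next
  case (Suc n)
  note f = Ck_on_SucD[OF Suc.prems(1)] and g = Ck_on_SucD[OF Suc.prems(2)]
  show ?case
    by (rule Ck_on_SucI[OF \<open>open S\<close>]) (rule has_derivative_Pair f g Suc.IH | assumption)+
qed

lemma orthogonal_expansion:
  fixes C :: "'a::real_inner set"
  assumes "finite C" "pairwise orthogonal C" "x \<in> span C"
  shows "x = (\<Sum>c\<in>C. (x \<bullet> c / (c \<bullet> c)) *\<^sub>R c)"
proof -
  obtain u where u: "x = (\<Sum>c\<in>C. u c *\<^sub>R c)"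
    using assms by (auto simp: span_finite)
  have "(x \<bullet> c / (c \<bullet> c)) *\<^sub>R c = u c *\<^sub>R c" if "c \<in> C" for c
  proof -
    have "x \<bullet> c = (\<Sum>b\<in>C. u b * (b \<bullet> c))"
      by (simp add: u inner_sum_left)
    also have "\<dots> = (\<Sum>b\<in>{c}. u b * (b \<bullet> c))"
      using assms(1,2) that
      by (intro sum.mono_neutral_right) (auto simp: pairwise_def orthogonal_def)
    finally show ?thesis by auto
  qed
  then show ?thesis
    using u by (metis (no_types, lifting) sum.cong)
qed

text \<open>
  The derivative of a composite in a direction \<open>v\<close> is the derivative of \<open>g\<close> in the direction
  \<open>Df(x) v\<close>, which moves with \<open>x\<close>, whereas the induction hypothesis speaks about fixed directions.
  Expanding \<open>Df(x) v\<close> in an orthogonal basis of the middle space removes this discrepancy; this is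
  where finite dimension enters.
\<close>

lemma Ck_on_compose:
  fixes f :: "'a::real_normed_vector \<Rightarrow> 'b::real_inner"
  assumes "\<exists>B::'b set. finite B \<and> span B = UNIV"
    and "open S" "open T" "\<And>x. x \<in> S \<Longrightarrow> f x \<in> T" "Ck_on n S f" "Ck_on n T g"
  shows "Ck_on n S (\<lambda>x. g (f x))"
proof -
  obtain C :: "'b set" where C: "finite C" "span C = UNIV" "pairwise orthogonal C"
    using assms(1) basis_orthogonal by metis
  show ?thesis
    using assms(5,6)
  proof (induction n arbitrary: g)
    case 0
    then show ?case
      using assms(4) by (auto intro: continuous_on_compose2)
  next
    case (Suc n)
    note f = Ck_on_SucD[OF Suc.prems(1)] and g = Ck_on_SucD[OF Suc.prems(2)]
    \<comment> \<open>A zero vector in \<open>C\<close> contributes 0, as division by 0 gives 0.\<close>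
    define D where "D x v = (\<Sum>c\<in>C. (frechet_derivative f (at x) v \<bullet> c / (c \<bullet> c)) *\<^sub>R
        frechet_derivative g (at (f x)) c)" for x v
    have D: "((\<lambda>x. g (f x)) has_derivative D x) (at x)" if "x \<in> S" for x
    proof -
      have g': "(g has_derivative frechet_derivative g (at (f x))) (at (f x))"
        using g(1) assms(4) that by blast
      interpret bounded_linear "frechet_derivative g (at (f x))"
        using g' by (rule has_derivative_bounded_linear)
      have "frechet_derivative g (at (f x)) (frechet_derivative f (at x) v) = D x v" for v
        using arg_cong[OF orthogonal_expansion[OF C(1,3)], of "frechet_derivative f (at x) v"
            "frechet_derivative g (at (f x))"] C(2)
        by (simp add: sum scaleR D_def)
      then have "frechet_derivative g (at (f x)) \<circ> frechet_derivative f (at x) = D x"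
        by auto
      then show ?thesis
        using diff_chain_at[OF f(1)[OF that] g'] by (simp add: o_def)
    qed
    have "Ck_on n S (\<lambda>x. D x v)" for v
      unfolding D_def
    proof (intro Ck_on_sum Ck_on_bilinear[OF bounded_bilinear_scaleR] assms(2) C(1))
      fix c assume "c \<in> C"
      have "Ck_on n S (\<lambda>x. frechet_derivative f (at x) v \<bullet> (c /\<^sub>R (c \<bullet> c)))"
        by (intro Ck_on_bilinear[OF bounded_bilinear_inner] assms(2) f Ck_on_const)
      then show "Ck_on n S (\<lambda>x. frechet_derivative f (at x) v \<bullet> c / (c \<bullet> c))"
        by (simp add: divide_inverse mult.commute)
      show "Ck_on n S (\<lambda>x. frechet_derivative g (at (f x)) c)"
        using Suc.IH[OF Ck_on_Suc_imp[OF Suc.prems(1)] g(2)] .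
    qed
    then show ?case
      using Ck_on_SucI[OF assms(2) D] by blast
  qed
qed

section \<open>Smooth maps between manifolds\<close>

text \<open>
  The properties of an atlas on which the smoothness of composites rests. They concern one chart at
  a time, so a product of manifolds is seen to have them by looking at one product chart at a time.
\<close>

definition charted :: "('p, 'e::real_inner) manifold \<Rightarrow> bool" where
  "charted M \<longleftrightarrow>
     (\<exists>B::'e set. finite B \<and> span B = UNIV) \<and>
     \<Union>(fst ` atlas M) = topspace (mtop M) \<and>
     (\<forall>(U, \<phi>) \<in> atlas M. openin (mtop M) U \<and> inj_on \<phi> U \<and>
        (\<forall>W. openin (mtop M) W \<and> W \<subseteq> U \<longrightarrow> open (\<phi> ` W)))"

lemma chartedD:
  assumes "charted M" "(U, \<phi>) \<in> atlas M"
  shows "openin (mtop M) U" "inj_on \<phi> U" "openin (mtop M) W \<Longrightarrow> W \<subseteq> U \<Longrightarrow> open (\<phi> ` W)"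
    and "U \<subseteq> topspace (mtop M)"
proof -
  have "openin (mtop M) U \<and> inj_on \<phi> U \<and> (\<forall>W. openin (mtop M) W \<and> W \<subseteq> U \<longrightarrow> open (\<phi> ` W))"
    using assms unfolding charted_def by blast
  then show "openin (mtop M) U" "inj_on \<phi> U" "openin (mtop M) W \<Longrightarrow> W \<subseteq> U \<Longrightarrow> open (\<phi> ` W)"
    "U \<subseteq> topspace (mtop M)"
    by (simp_all add: openin_subset)
qed

lemma charted_cover:
  assumes "charted M" "p \<in> topspace (mtop M)"
  obtains U \<phi> where "(U, \<phi>) \<in> atlas M" "p \<in> U"
proof -
  have "p \<in> \<Union>(fst ` atlas M)"
    using assms unfolding charted_def by blast
  then show thesis
    using that by (auto simp: image_iff)
qed

lemma smooth_manifold_charted: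
  fixes M :: "('p, 'e::real_inner) manifold"
  assumes "smooth_manifold M"
  shows "charted M"
proof -
  have "inj_on \<phi> U \<and> (\<forall>W. openin (mtop M) W \<and> W \<subseteq> U \<longrightarrow> open (\<phi> ` W))"
    if "(U, \<phi>) \<in> atlas M" for U \<phi>
  proof -
    have U: "openin (mtop M) U" and o: "open (\<phi> ` U)"
      and h: "homeomorphic_map (subtopology (mtop M) U) (top_of_set (\<phi> ` U)) \<phi>"
      using assms that unfolding smooth_manifold_def by blast+
    have "U \<subseteq> topspace (mtop M)"
      using U by (rule openin_subset)
    then have "inj_on \<phi> U"
      using homeomorphic_imp_injective_map[OF h] by (simp add: Int_absorb1)
    moreover have "open (\<phi> ` W)" if "openin (mtop M) W" "W \<subseteq> U" for W
    proof -
      have "openin (subtopology (mtop M) U) W"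
        using that U by (simp add: openin_open_subtopology)
      then have "openin (top_of_set (\<phi> ` U)) (\<phi> ` W)"
        using homeomorphic_imp_open_map[OF h] by (simp add: open_map_def)
      then show ?thesis
        using o openin_open_eq by blast
    qed
    ultimately show ?thesis by blast
  qed
  moreover have "openin (mtop M) U" if "(U, \<phi>) \<in> atlas M" for U \<phi>
    using assms that unfolding smooth_manifold_def by blast
  moreover have "\<exists>B::'e set. finite B \<and> span B = UNIV" "\<Union>(fst ` atlas M) = topspace (mtop M)"
    using assms unfolding smooth_manifold_def by blast+
  ultimately show ?thesis
    unfolding charted_def by blast
qed

lemma charted_prod_manifold:
  fixes M :: "('p, 'e::real_inner) manifold" and N :: "('q, 'f::real_inner) manifold"
  assumes M: "charted M" and N: "charted N"
  shows "charted (prod_manifold M N)"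
proof -
  obtain B :: "'e set" where B: "finite B" "span B = UNIV"
    using M unfolding charted_def by blast
  obtain C :: "'f set" where C: "finite C" "span C = UNIV"
    using N unfolding charted_def by blast
  have "span (B \<times> {0} \<union> {0} \<times> C) = UNIV"
  proof -
    have "(a, b) \<in> span (B \<times> {0} \<union> {0} \<times> C)" for a b
    proof -
      have "(x, 0) \<in> span (B \<times> {0} \<union> {0} \<times> C)" if "x \<in> span B" for x :: 'e
        using that
      proof (induction rule: span_induct_alt)
        case base
        then show ?case using span_zero[of "B \<times> {0} \<union> {0} \<times> C"] by (simp add: zero_prod_def)
      next
        case (step c x y)
        have "c *\<^sub>R (x, 0) + (y, 0) \<in> span (B \<times> {0} \<union> {0} \<times> C)"
          using step by (intro span_add span_scale) (auto intro: span_base)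
        then show ?case by simp
      qed
      moreover have "(0, x) \<in> span (B \<times> {0} \<union> {0} \<times> C)" if "x \<in> span C" for x :: 'f
        using that
      proof (induction rule: span_induct_alt)
        case base
        then show ?case using span_zero[of "B \<times> {0} \<union> {0} \<times> C"] by (simp add: zero_prod_def)
      next
        case (step c x y)
        have "c *\<^sub>R (0, x) + (0, y) \<in> span (B \<times> {0} \<union> {0} \<times> C)"
          using step by (intro span_add span_scale) (auto intro: span_base)
        then show ?case by simp
      qed
      ultimately have "(a, 0) + (0, b) \<in> span (B \<times> {0} \<union> {0} \<times> C)"
        using B(2) C(2) by (intro span_add) auto
      then show ?thesis by simp
    qed
    then show ?thesis by auto
  qed
  then have fin: "\<exists>D::('e \<times> 'f) set. finite D \<and> span D = UNIV"
    using B(1) C(1) by (intro exI[of _ "B \<times> {0} \<union> {0} \<times> C"]) auto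
  have cov: "\<Union>(fst ` atlas (prod_manifold M N)) = topspace (mtop (prod_manifold M N))"
  proof (intro equalityI subsetI)
    fix z assume "z \<in> \<Union>(fst ` atlas (prod_manifold M N))"
    then show "z \<in> topspace (mtop (prod_manifold M N))"
      using chartedD(4)[OF M] chartedD(4)[OF N] by (fastforce simp: prod_manifold_def)
  next
    fix z assume "z \<in> topspace (mtop (prod_manifold M N))"
    then obtain x y where z: "z = (x, y)" "x \<in> topspace (mtop M)" "y \<in> topspace (mtop N)"
      by (auto simp: prod_manifold_def)
    obtain U \<phi> where "(U, \<phi>) \<in> atlas M" "x \<in> U"
      using charted_cover[OF M z(2)] .
    moreover obtain V \<psi> where "(V, \<psi>) \<in> atlas N" "y \<in> V"
      using charted_cover[OF N z(3)] .
    ultimately have "(U \<times> V, map_prod \<phi> \<psi>) \<in> atlas (prod_manifold M N)" "z \<in> U \<times> V"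
      using z by (auto simp: prod_manifold_def)
    then show "z \<in> \<Union>(fst ` atlas (prod_manifold M N))" by force
  qed
  have ch: "openin (prod_topology (mtop M) (mtop N)) (U \<times> V)" "inj_on (map_prod \<phi> \<psi>) (U \<times> V)"
    "\<forall>W. openin (prod_topology (mtop M) (mtop N)) W \<and> W \<subseteq> U \<times> V \<longrightarrow> open (map_prod \<phi> \<psi> ` W)"
    if U: "(U, \<phi>) \<in> atlas M" and V: "(V, \<psi>) \<in> atlas N" for U V \<phi> \<psi>
  proof -
    note U = chartedD[OF M U] and V = chartedD[OF N V]
    show "openin (prod_topology (mtop M) (mtop N)) (U \<times> V)"
      using U V by (simp add: openin_prod_Times_iff)
    show "inj_on (map_prod \<phi> \<psi>) (U \<times> V)"
      using U V by (simp add: map_prod_inj_on)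
    show "\<forall>W. openin (prod_topology (mtop M) (mtop N)) W \<and> W \<subseteq> U \<times> V \<longrightarrow> open (map_prod \<phi> \<psi> ` W)"
    proof (intro allI impI, elim conjE)
      fix W assume W: "openin (prod_topology (mtop M) (mtop N)) W" "W \<subseteq> U \<times> V"
      show "open (map_prod \<phi> \<psi> ` W)"
        unfolding open_prod_def
      proof
        fix z assume "z \<in> map_prod \<phi> \<psi> ` W"
        then obtain x y where z: "z = (\<phi> x, \<psi> y)" "(x, y) \<in> W" by auto
        then obtain A A' where A: "openin (mtop M) A" "openin (mtop N) A'" "x \<in> A" "y \<in> A'"
            "A \<times> A' \<subseteq> W"
          using W(1) unfolding openin_prod_topology_alt by metis
        have "A \<subseteq> U" "A' \<subseteq> V" using A W(2) by auto
        then have "open (\<phi> ` A)" "open (\<psi> ` A')" using A U(3) V(3) by auto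
        moreover have "z \<in> \<phi> ` A \<times> \<psi> ` A'" "\<phi> ` A \<times> \<psi> ` A' \<subseteq> map_prod \<phi> \<psi> ` W"
          using z A by (force simp: map_prod_def)+
        ultimately show "\<exists>A B. open A \<and> open B \<and> z \<in> A \<times> B \<and> A \<times> B \<subseteq> map_prod \<phi> \<psi> ` W"
          by blast
      qed
    qed
  qed
  show ?thesis
    unfolding charted_def using fin cov ch by (auto simp: prod_manifold_def)
qed

lemma chart_domain_open:
  assumes "charted M" "(U, \<phi>) \<in> atlas M" "continuous_map (mtop M) X F" "openin X V"
  shows "openin (mtop M) (U \<inter> F -` V)" "open (\<phi> ` (U \<inter> F -` V))"
proof -
  note U = chartedD[OF assms(1,2)]
  have "openin (mtop M) (U \<inter> {x \<in> topspace (mtop M). F x \<in> V})"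
    using U(1) openin_continuous_map_preimage[OF assms(3,4)] by blast
  moreover have "U \<inter> {x \<in> topspace (mtop M). F x \<in> V} = U \<inter> F -` V"
    using U(4) by auto
  ultimately show "openin (mtop M) (U \<inter> F -` V)" by simp
  then show "open (\<phi> ` (U \<inter> F -` V))" using U(3) by blast
qed

lemma smooth_map_continuous: "smooth_map M N F \<Longrightarrow> continuous_map (mtop M) (mtop N) F"
  by (simp add: smooth_map_def)

lemma smooth_map_Ck:
  "smooth_map M N F \<Longrightarrow> (U, \<phi>) \<in> atlas M \<Longrightarrow> (V, \<psi>) \<in> atlas N \<Longrightarrow>
    Ck_on n (\<phi> ` (U \<inter> F -` V)) (\<psi> \<circ> F \<circ> inv_into U \<phi>)"
  unfolding smooth_map_def smooth_on_def by fast

lemma smooth_mapI: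
  assumes "continuous_map (mtop M) (mtop N) F"
    and "\<And>U \<phi> V \<psi> n. (U, \<phi>) \<in> atlas M \<Longrightarrow> (V, \<psi>) \<in> atlas N \<Longrightarrow>
      Ck_on n (\<phi> ` (U \<inter> F -` V)) (\<psi> \<circ> F \<circ> inv_into U \<phi>)"
  shows "smooth_map M N F"
  using assms unfolding smooth_map_def smooth_on_def by fast

text \<open>
  Coordinate expressions evaluate a map only on chart domains, which lie in the underlying space.
  Identities of the group laws, which hold on the carrier alone, may thus be used to rewrite smooth
  maps.
\<close>

lemma smooth_map_cong:
  assumes "charted M" "charted N" "smooth_map M N F" "\<And>x. x \<in> topspace (mtop M) \<Longrightarrow> F x = F' x"
  shows "smooth_map M N F'"
proof (rule smooth_mapI)
  show "continuous_map (mtop M) (mtop N) F'"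
    using continuous_map_eq[OF smooth_map_continuous[OF assms(3)]] assms(4) by blast
next
  fix U \<phi> V \<psi> n assume U: "(U, \<phi>) \<in> atlas M" and V: "(V, \<psi>) \<in> atlas N"
  have eq: "F x = F' x" if "x \<in> U" for x
    using assms(4) chartedD(4)[OF assms(1) U] that by blast
  then have "U \<inter> F' -` V = U \<inter> F -` V" by auto
  moreover have "Ck_on n (\<phi> ` (U \<inter> F -` V)) (\<psi> \<circ> F' \<circ> inv_into U \<phi>)"
    by (rule Ck_on_cong[OF _ _ smooth_map_Ck[OF assms(3) U V]])
      (use eq chart_domain_open(2)[OF assms(1) U smooth_map_continuous[OF assms(3)]
        chartedD(1)[OF assms(2) V]] in \<open>auto simp: chartedD(2)[OF assms(1) U]\<close>)
  ultimately show "Ck_on n (\<phi> ` (U \<inter> F' -` V)) (\<psi> \<circ> F' \<circ> inv_into U \<phi>)" by simp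
qed

lemma smooth_map_const:
  assumes "charted M" "charted N" "c \<in> topspace (mtop N)"
  shows "smooth_map M N (\<lambda>x. c)"
proof (rule smooth_mapI)
  show c: "continuous_map (mtop M) (mtop N) (\<lambda>x. c)" using assms(3) by simp
  fix U \<phi> V \<psi> n assume U: "(U, \<phi>) \<in> atlas M" and V: "(V, \<psi>) \<in> atlas N"
  show "Ck_on n (\<phi> ` (U \<inter> (\<lambda>x. c) -` V)) (\<psi> \<circ> (\<lambda>x. c) \<circ> inv_into U \<phi>)"
    using Ck_on_const[OF chart_domain_open(2)[OF assms(1) U c chartedD(1)[OF assms(2) V]],
        of n "\<psi> c"]
    by (simp add: o_def)
qed

lemma smooth_map_id: "smooth_manifold M \<Longrightarrow> smooth_map M M (\<lambda>x. x)"
  by (fastforce simp: smooth_map_def smooth_manifold_def o_def)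

lemma smooth_map_compose:
  fixes N :: "('q, 'f::real_inner) manifold"
  assumes M: "charted M" and N: "charted N" and P: "charted P"
    and F: "smooth_map M N F" and H: "smooth_map N P H"
  shows "smooth_map M P (\<lambda>x. H (F x))"
proof (rule smooth_mapI)
  show c: "continuous_map (mtop M) (mtop P) (\<lambda>x. H (F x))"
    using continuous_map_compose[OF F[THEN smooth_map_continuous] H[THEN smooth_map_continuous]]
    by (simp add: o_def)
  fix U \<phi> W \<psi> n assume U: "(U, \<phi>) \<in> atlas M" and W: "(W, \<psi>) \<in> atlas P"
  let ?h = "\<psi> \<circ> (\<lambda>x. H (F x)) \<circ> inv_into U \<phi>"
  show "Ck_on n (\<phi> ` (U \<inter> (\<lambda>x. H (F x)) -` W)) ?h"
  proof (rule Ck_on_local)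
    \<comment> \<open>Near \<open>y\<close>, the composite in coordinates factors through a chart of \<open>N\<close> around \<open>F p\<close>.\<close>
    fix y assume "y \<in> \<phi> ` (U \<inter> (\<lambda>x. H (F x)) -` W)"
    then obtain p where p: "y = \<phi> p" "p \<in> U" "H (F p) \<in> W" by auto
    have "F p \<in> topspace (mtop N)"
      using p(2) chartedD(4)[OF M U]
        continuous_map_image_subset_topspace[OF F[THEN smooth_map_continuous]] by blast
    then obtain V \<theta> where V: "(V, \<theta>) \<in> atlas N" "F p \<in> V"
      using charted_cover[OF N] by blast
    define T where "T = \<phi> ` ((U \<inter> F -` V) \<inter> (U \<inter> (\<lambda>x. H (F x)) -` W))"
    have "open T"
      unfolding T_def
      using chart_domain_open(1)[OF M U F[THEN smooth_map_continuous] chartedD(1)[OF N V(1)]]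
        chart_domain_open(1)[OF M U c chartedD(1)[OF P W]]
      by (intro chartedD(3)[OF M U]) auto
    moreover have "y \<in> T" using p V(2) by (auto simp: T_def)
    moreover have "Ck_on n T ?h"
    proof (rule Ck_on_cong[OF \<open>open T\<close>])
      show "Ck_on n T (\<lambda>x. (\<psi> \<circ> H \<circ> inv_into V \<theta>) ((\<theta> \<circ> F \<circ> inv_into U \<phi>) x))"
      proof (rule Ck_on_compose[where T = "\<theta> ` (V \<inter> H -` W)" and
            g = "\<psi> \<circ> H \<circ> inv_into V \<theta>" and f = "\<theta> \<circ> F \<circ> inv_into U \<phi>", OF _ \<open>open T\<close>])
        show "\<exists>B::'f set. finite B \<and> span B = UNIV"
          using N unfolding charted_def by blast
        show "open (\<theta> ` (V \<inter> H -` W))"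
          using chart_domain_open(2)[OF N V(1) H[THEN smooth_map_continuous] chartedD(1)[OF P W]] .
        show "Ck_on n T (\<theta> \<circ> F \<circ> inv_into U \<phi>)"
          by (rule Ck_on_subset[OF smooth_map_Ck[OF F U V(1)]]) (auto simp: T_def)
        show "Ck_on n (\<theta> ` (V \<inter> H -` W)) (\<psi> \<circ> H \<circ> inv_into V \<theta>)"
          using smooth_map_Ck[OF H V(1) W] .
      qed (auto simp: T_def chartedD(2)[OF M U])
    qed (auto simp: T_def chartedD(2)[OF M U] chartedD(2)[OF N V(1)])
    ultimately show "\<exists>T. open T \<and> y \<in> T \<and> Ck_on n T ?h" by blast
  qed
qed

lemma smooth_map_Pair:
  assumes M: "charted M" and N: "charted N" and P: "charted P"
    and F: "smooth_map M N F" and H: "smooth_map M P H"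
  shows "smooth_map M (prod_manifold N P) (\<lambda>x. (F x, H x))"
proof (rule smooth_mapI)
  show c: "continuous_map (mtop M) (mtop (prod_manifold N P)) (\<lambda>x. (F x, H x))"
    using F H by (simp add: smooth_map_continuous prod_manifold_def continuous_map_paired)
  fix U \<phi> W \<theta> n assume U: "(U, \<phi>) \<in> atlas M" and "(W, \<theta>) \<in> atlas (prod_manifold N P)"
  then obtain V1 \<psi>1 V2 \<psi>2 where W: "W = V1 \<times> V2" "\<theta> = map_prod \<psi>1 \<psi>2"
    and V: "(V1, \<psi>1) \<in> atlas N" "(V2, \<psi>2) \<in> atlas P"
    by (auto simp: prod_manifold_def)
  let ?S = "\<phi> ` (U \<inter> (\<lambda>x. (F x, H x)) -` W)"
  have o: "open ?S"
    using chart_domain_open(2)[OF M U c] chartedD(1)[OF charted_prod_manifold[OF N P]]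
      \<open>(W, \<theta>) \<in> _\<close> by blast
  have S: "?S \<subseteq> \<phi> ` (U \<inter> F -` V1)" "?S \<subseteq> \<phi> ` (U \<inter> H -` V2)"
    unfolding W by blast+
  have "Ck_on n ?S (\<psi>1 \<circ> F \<circ> inv_into U \<phi>)" "Ck_on n ?S (\<psi>2 \<circ> H \<circ> inv_into U \<phi>)"
    using Ck_on_subset[OF smooth_map_Ck[OF F U V(1)] S(1)]
      Ck_on_subset[OF smooth_map_Ck[OF H U V(2)] S(2)] .
  then have "Ck_on n ?S (\<lambda>x. ((\<psi>1 \<circ> F \<circ> inv_into U \<phi>) x, (\<psi>2 \<circ> H \<circ> inv_into U \<phi>) x))"
    by (rule Ck_on_Pair[OF o])
  then show "Ck_on n ?S (\<theta> \<circ> (\<lambda>x. (F x, H x)) \<circ> inv_into U \<phi>)"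
    by (simp add: W o_def)
qed

section \<open>Smooth functions on the line and on the plane\<close>

lemma charted_real_line: "charted real_line"
proof -
  have "x \<in> span {1}" for x :: real
    using span_scale[OF span_base[of 1 "{1::real}"], of x] by simp
  then have "\<exists>B::real set. finite B \<and> span B = UNIV"
    by (intro exI[of _ "{1}"]) auto
  then show ?thesis
    unfolding charted_def by (simp add: real_line_def)
qed

text \<open>
  The plane carries the arithmetic operations, whose smoothness makes the smooth functions on a
  manifold an algebra, and it is the parameter space for pairs of curves.
\<close>

abbreviation plane :: "(real \<times> real, real \<times> real) manifold" where
  "plane \<equiv> prod_manifold real_line real_line"

lemma charted_plane: "charted plane"
  by (intro charted_prod_manifold charted_real_line)

lemma plane_eq: "plane = \<lparr>mtop = euclidean, atlas = {(UNIV, \<lambda>z. z)}\<rparr>"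
  by (auto simp: prod_manifold_def real_line_def euclidean_product_topology map_prod_def)

lemma smooth_map_line_iff: "smooth_map real_line real_line f \<longleftrightarrow> (\<forall>n. Ck_on n UNIV f)"
proof
  assume "smooth_map real_line real_line f"
  then show "\<forall>n. Ck_on n UNIV f"
    using smooth_map_Ck[of real_line real_line f UNIV "\<lambda>x. x" UNIV "\<lambda>x. x"]
    by (auto simp: real_line_def o_def inv_into_def)
next
  assume *: "\<forall>n. Ck_on n UNIV f"
  then have "Ck_on 0 UNIV f" by blast
  then have "continuous_on UNIV f" by simp
  with * show "smooth_map real_line real_line f"
    by (intro smooth_mapI) (auto simp: real_line_def o_def inv_into_def)
qed

lemma smooth_map_plane_iff: "smooth_map plane real_line f \<longleftrightarrow> (\<forall>n. Ck_on n UNIV f)"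
proof
  assume "smooth_map plane real_line f"
  then show "\<forall>n. Ck_on n UNIV f"
    using smooth_map_Ck[of plane real_line f UNIV "\<lambda>x. x" UNIV "\<lambda>x. x"]
    unfolding plane_eq by (auto simp: real_line_def o_def inv_into_def)
next
  assume *: "\<forall>n. Ck_on n UNIV f"
  then have "Ck_on 0 UNIV f" by blast
  then have "continuous_on UNIV f" by simp
  with * show "smooth_map plane real_line f"
    unfolding plane_eq
    by (intro smooth_mapI) (auto simp: real_line_def o_def inv_into_def)
qed

lemma smooth_map_fst_plane: "smooth_map plane real_line fst"
  and smooth_map_snd_plane: "smooth_map plane real_line snd"
  by (auto simp: smooth_map_plane_iff intro!: Ck_on_bounded_linear bounded_linear_fst bounded_linear_snd)

lemma smooth_map_add_plane: "smooth_map plane real_line (\<lambda>z. fst z + snd z)"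
  by (auto simp: smooth_map_plane_iff
      intro!: Ck_on_bounded_linear bounded_linear_add bounded_linear_fst bounded_linear_snd)

lemma smooth_map_mult_plane: "smooth_map plane real_line (\<lambda>z. fst z * snd z)"
  unfolding smooth_map_plane_iff
  by (intro allI Ck_on_bilinear[OF bounded_bilinear_mult] open_UNIV
      Ck_on_bounded_linear bounded_linear_fst bounded_linear_snd)

lemma smooth_line_DERIV:
  assumes "smooth_map real_line real_line f"
  shows "(f has_real_derivative deriv f t) (at t)"
proof -
  have "Ck_on (Suc 0) UNIV f"
    using assms smooth_map_line_iff by blast
  then have "f differentiable (at t)" by simp
  then show ?thesis
    by (simp add: real_differentiableE DERIV_imp_deriv DERIV_deriv_iff_real_differentiable)
qed

lemma deriv_diagonal:
  assumes "smooth_map plane real_line f"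
  shows "deriv (\<lambda>s. f (s, s)) t = deriv (\<lambda>s. f (s, t)) t + deriv (\<lambda>s. f (t, s)) t"
proof -
  have "Ck_on (Suc 0) UNIV f"
    using assms smooth_map_plane_iff by blast
  then have "f differentiable (at (t, t))" by simp
  then obtain D where D: "(f has_derivative D) (at (t, t))"
    unfolding differentiable_def by blast
  interpret D: bounded_linear D using D by (rule has_derivative_bounded_linear)
  \<comment> \<open>All three derivatives in question are values of the same linear map \<open>D\<close>.\<close>
  have *: "deriv (\<lambda>s. f (a s, b s)) t = D (a', b')"
    if "(a has_real_derivative a') (at t)" "(b has_real_derivative b') (at t)" "a t = t" "b t = t"
    for a b :: "real \<Rightarrow> real" and a' b'
  proof -
    have "((\<lambda>s. (a s, b s)) has_derivative (\<lambda>h. (h * a', h * b'))) (at t)"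
      using that by (intro has_derivative_Pair) (simp_all add: has_field_derivative_def mult_commute_abs)
    then have "(f \<circ> (\<lambda>s. (a s, b s)) has_derivative D \<circ> (\<lambda>h. (h * a', h * b'))) (at t)"
      by (rule diff_chain_at) (use D that in simp)
    moreover have "D (h * a', h * b') = D (a', b') * h" for h
      using D.scaleR[of h "(a', b')"] by simp
    ultimately have "((\<lambda>s. f (a s, b s)) has_real_derivative D (a', b')) (at t)"
      by (simp add: has_field_derivative_def o_def mult_commute_abs)
    then show ?thesis by (rule DERIV_imp_deriv)
  qed
  have "deriv (\<lambda>s. f (s, s)) t = D (1, 1)" "deriv (\<lambda>s. f (s, t)) t = D (1, 0)"
    "deriv (\<lambda>s. f (t, s)) t = D (0, 1)"
    by (rule *; simp)+
  then show ?thesis using D.add[of "(1, 0)" "(0, 1)"] by simp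
qed

section \<open>Algebras of smooth functions and tangent vectors\<close>

lemma smooth_funs_compose:
  assumes "charted M" "charted N" "smooth_map M N F" "f \<in> smooth_funs N"
  shows "f \<circ> F \<in> smooth_funs M"
  using smooth_map_compose[OF assms(1,2) charted_real_line assms(3), of f] assms(4)
  by (simp add: smooth_funs_def o_def)

lemma smooth_funs_const: "charted M \<Longrightarrow> (\<lambda>x. c) \<in> smooth_funs M"
  using smooth_map_const[OF _ charted_real_line, of M c]
  by (simp add: smooth_funs_def) (simp add: real_line_def)

lemma smooth_funs_plane:
  assumes "charted M" "smooth_map plane real_line h" "f \<in> smooth_funs M" "g \<in> smooth_funs M"
  shows "(\<lambda>x. h (f x, g x)) \<in> smooth_funs M"
  using assms unfolding smooth_funs_def
  by (auto intro!: smooth_map_compose[where N = plane and H = h] smooth_map_Pair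
      charted_plane charted_real_line)

lemma smooth_funs_add:
  "charted M \<Longrightarrow> f \<in> smooth_funs M \<Longrightarrow> g \<in> smooth_funs M \<Longrightarrow> (\<lambda>x. f x + g x) \<in> smooth_funs M"
  using smooth_funs_plane[OF _ smooth_map_add_plane] by fastforce

lemma smooth_funs_mult:
  "charted M \<Longrightarrow> f \<in> smooth_funs M \<Longrightarrow> g \<in> smooth_funs M \<Longrightarrow> (\<lambda>x. f x * g x) \<in> smooth_funs M"
  using smooth_funs_plane[OF _ smooth_map_mult_plane] by fastforce

lemma smooth_funs_cmult:
  "charted M \<Longrightarrow> f \<in> smooth_funs M \<Longrightarrow> (\<lambda>x. c * f x) \<in> smooth_funs M"
  by (rule smooth_funs_mult[OF _ smooth_funs_const])

lemma tangent_spaceD: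
  assumes "X \<in> tangent_space M p"
  shows "f \<in> smooth_funs M \<Longrightarrow> g \<in> smooth_funs M \<Longrightarrow> X (\<lambda>x. f x + g x) = X f + X g"
    and "f \<in> smooth_funs M \<Longrightarrow> X (\<lambda>x. c * f x) = c * X f"
    and "f \<in> smooth_funs M \<Longrightarrow> g \<in> smooth_funs M \<Longrightarrow> X (\<lambda>x. f x * g x) = f p * X g + g p * X f"
    and "f \<notin> smooth_funs M \<Longrightarrow> X f = 0"
  using assms unfolding tangent_space_def by auto

text \<open>
  A function \<open>h\<close> vanishing on the manifold is its own product with the indicator function of the
  complement, and the Leibniz rule kills such a product. Smoothness of both factors is seen by
  comparing them with 0 on the manifold.
\<close>

lemma tangent_vector_cong:
  assumes M: "charted M" and p: "p \<in> topspace (mtop M)" and X: "X \<in> tangent_space M p"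
    and f: "f \<in> smooth_funs M" and g: "g \<in> smooth_funs M"
    and eq: "\<And>x. x \<in> topspace (mtop M) \<Longrightarrow> f x = g x"
  shows "X f = X g"
proof -
  have vanish: "h \<in> smooth_funs M" if "\<And>x. x \<in> topspace (mtop M) \<Longrightarrow> h x = 0" for h
    using smooth_map_cong[OF M charted_real_line, of "\<lambda>x. 0" h] smooth_funs_const[OF M, of 0] that
    by (simp add: smooth_funs_def)
  define h where "h = (\<lambda>x. f x - g x)"
  define e where "e = (\<lambda>x. if x \<in> topspace (mtop M) then 0 else 1 :: real)"
  have h: "h \<in> smooth_funs M" and e: "e \<in> smooth_funs M"
    using eq by (auto intro!: vanish simp: h_def e_def)
  have "h = (\<lambda>x. h x * e x)"
    using eq by (auto simp: h_def e_def)
  then have "X h = X (\<lambda>x. h x * e x)" by simp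
  also have "\<dots> = h p * X e + e p * X h"
    by (rule tangent_spaceD(3)[OF X h e])
  also have "\<dots> = 0"
    using p eq by (simp add: h_def e_def)
  finally have "X (\<lambda>x. g x + h x) = X g"
    using tangent_spaceD(1)[OF X g h] by simp
  then show ?thesis by (simp add: h_def)
qed

lemma vec_add_assoc: "vec_add (vec_add X Y) Z = vec_add X (vec_add Y Z)"
  by (simp add: vec_add_def add.assoc)

lemma vec_add_tangent:
  "X \<in> tangent_space M p \<Longrightarrow> Y \<in> tangent_space M p \<Longrightarrow> vec_add X Y \<in> tangent_space M p"
  unfolding tangent_space_def vec_add_def by (auto simp: algebra_simps)

lemma vec_scale_tangent: "X \<in> tangent_space M p \<Longrightarrow> vec_scale c X \<in> tangent_space M p"
  unfolding tangent_space_def vec_scale_def by (auto simp: algebra_simps)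

lemma vec_zero_tangent: "vec_zero \<in> tangent_space M p"
  unfolding tangent_space_def vec_zero_def by auto

lemma differential_tangent:
  assumes "charted M" "charted N" "smooth_map M N F" "X \<in> tangent_space M p"
  shows "differential N F X \<in> tangent_space N (F p)"
proof -
  note D = tangent_spaceD[OF assms(4)] and c = smooth_funs_compose[OF assms(1-3)]
  show ?thesis
    unfolding tangent_space_def differential_def mem_Collect_eq
  proof (intro conjI ballI allI impI)
    fix f g assume fg: "f \<in> smooth_funs N" "g \<in> smooth_funs N"
    show "(if (\<lambda>x. f x + g x) \<in> smooth_funs N then X ((\<lambda>x. f x + g x) \<circ> F) else 0) =
      (if f \<in> smooth_funs N then X (f \<circ> F) else 0) + (if g \<in> smooth_funs N then X (g \<circ> F) else 0)"
      using fg smooth_funs_add[OF assms(2) fg] D(1)[OF c c] by (simp add: o_def)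
    show "(if (\<lambda>x. f x * g x) \<in> smooth_funs N then X ((\<lambda>x. f x * g x) \<circ> F) else 0) =
      f (F p) * (if g \<in> smooth_funs N then X (g \<circ> F) else 0) +
      g (F p) * (if f \<in> smooth_funs N then X (f \<circ> F) else 0)"
      using fg smooth_funs_mult[OF assms(2) fg] D(3)[OF c c] by (simp add: o_def)
  next
    fix f a assume f: "f \<in> smooth_funs N"
    show "(if (\<lambda>x. a * f x) \<in> smooth_funs N then X ((\<lambda>x. a * f x) \<circ> F) else 0) =
      a * (if f \<in> smooth_funs N then X (f \<circ> F) else 0)"
      using f smooth_funs_cmult[OF assms(2) f] D(2)[OF c[OF f]] by (simp add: o_def)
  qed auto
qed

lemma differential_vec_add: "differential N F (vec_add X Y) = vec_add (differential N F X) (differential N F Y)"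
  and differential_vec_scale: "differential N F (vec_scale c X) = vec_scale c (differential N F X)"
  by (auto simp: differential_def vec_add_def vec_scale_def)

lemma differential_compose:
  assumes "charted N" "charted P" "smooth_map N P H"
  shows "differential P H (differential N F X) = differential P (\<lambda>x. H (F x)) X"
proof
  fix f
  show "differential P H (differential N F X) f = differential P (\<lambda>x. H (F x)) X f"
    using smooth_funs_compose[OF assms] by (auto simp: differential_def o_def)
qed

text \<open>
  The maps compared here agree only on the manifold, as is the case for conjugations whose equality
  follows from the group laws.
\<close>

lemma differential_cong:
  assumes M: "charted M" and N: "charted N" and F: "smooth_map M N F"
    and p: "p \<in> topspace (mtop M)" and X: "X \<in> tangent_space M p"
    and eq: "\<And>x. x \<in> topspace (mtop M) \<Longrightarrow> F x = F' x"
  shows "differential N F X = differential N F' X"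
proof
  fix f
  have F': "smooth_map M N F'"
    using smooth_map_cong[OF M N F] eq by blast
  have "X (f \<circ> F) = X (f \<circ> F')" if "f \<in> smooth_funs N"
    by (rule tangent_vector_cong[OF M p X])
      (use eq that smooth_funs_compose[OF M N F] smooth_funs_compose[OF M N F'] in auto)
  then show "differential N F X f = differential N F' X f"
    by (simp add: differential_def)
qed

lemma differential_id:
  assumes "X \<in> tangent_space M p"
  shows "differential M (\<lambda>x. x) X = X"
  using tangent_spaceD(4)[OF assms] by (auto simp: differential_def o_def)

lemma velocity_tangent:
  assumes M: "charted M" and \<gamma>: "smooth_map real_line M \<gamma>"
  shows "velocity M \<gamma> t \<in> tangent_space M (\<gamma> t)"
proof -
  have D: "((\<lambda>s. f (\<gamma> s)) has_real_derivative deriv (\<lambda>s. f (\<gamma> s)) t) (at t)"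
    if "f \<in> smooth_funs M" for f
    using smooth_line_DERIV[of "f \<circ> \<gamma>"] smooth_funs_compose[OF charted_real_line M \<gamma> that]
    by (simp add: smooth_funs_def o_def)
  show ?thesis
    unfolding tangent_space_def velocity_def mem_Collect_eq
  proof (intro conjI ballI allI impI)
    fix f g assume fg: "f \<in> smooth_funs M" "g \<in> smooth_funs M"
    show "(if (\<lambda>x. f x + g x) \<in> smooth_funs M then deriv (\<lambda>s. f (\<gamma> s) + g (\<gamma> s)) t else 0) =
      (if f \<in> smooth_funs M then deriv (\<lambda>s. f (\<gamma> s)) t else 0) +
      (if g \<in> smooth_funs M then deriv (\<lambda>s. g (\<gamma> s)) t else 0)"
      using fg smooth_funs_add[OF M fg] DERIV_imp_deriv[OF DERIV_add[OF D D]] by simp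
    show "(if (\<lambda>x. f x * g x) \<in> smooth_funs M then deriv (\<lambda>s. f (\<gamma> s) * g (\<gamma> s)) t else 0) =
      f (\<gamma> t) * (if g \<in> smooth_funs M then deriv (\<lambda>s. g (\<gamma> s)) t else 0) +
      g (\<gamma> t) * (if f \<in> smooth_funs M then deriv (\<lambda>s. f (\<gamma> s)) t else 0)"
      using fg smooth_funs_mult[OF M fg] DERIV_imp_deriv[OF DERIV_mult[OF D D]]
      by (simp add: mult.commute)
  next
    fix f a assume f: "f \<in> smooth_funs M"
    show "(if (\<lambda>x. a * f x) \<in> smooth_funs M then deriv (\<lambda>s. a * f (\<gamma> s)) t else 0) =
      a * (if f \<in> smooth_funs M then deriv (\<lambda>s. f (\<gamma> s)) t else 0)"
      using f smooth_funs_cmult[OF M f] DERIV_imp_deriv[OF DERIV_cmult[OF D]] by simp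
  qed auto
qed

lemma differential_velocity:
  assumes "charted N" "charted P" "smooth_map N P H"
  shows "differential P H (velocity N \<gamma> t) = velocity P (\<lambda>s. H (\<gamma> s)) t"
proof
  fix f
  show "differential P H (velocity N \<gamma> t) f = velocity P (\<lambda>s. H (\<gamma> s)) t f"
    using smooth_funs_compose[OF assms] by (auto simp: differential_def velocity_def)
qed

section \<open>The adjoint action and the product rule on a Lie group\<close>

context lie_group
begin

lemma charted: "charted M"
  using manifold by (rule smooth_manifold_charted)

lemma smooth_map_carrier:
  assumes "smooth_map P M F" "x \<in> topspace (mtop P)"
  shows "F x \<in> carrier G"
  using continuous_map_image_subset_topspace[OF smooth_map_continuous[OF assms(1)]] assms(2)
  unfolding carrier_eq by blast

lemma smooth_map_mult:
  assumes "charted P" "smooth_map P M F" "smooth_map P M H"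
  shows "smooth_map P M (\<lambda>x. F x \<otimes> H x)"
  using smooth_map_compose[OF assms(1) charted_prod_manifold[OF charted charted] charted
      smooth_map_Pair[OF assms(1) charted charted assms(2,3)] smooth_mult]
  by simp

lemma smooth_map_inv:
  assumes "charted P" "smooth_map P M F"
  shows "smooth_map P M (\<lambda>x. inv F x)"
  using smooth_map_compose[OF assms(1) charted charted assms(2) smooth_inv] .

lemma smooth_map_constant: "charted P \<Longrightarrow> c \<in> carrier G \<Longrightarrow> smooth_map P M (\<lambda>x. c)"
  by (simp add: smooth_map_const charted carrier_eq)

lemma smooth_right_translation: "a \<in> carrier G \<Longrightarrow> smooth_map M M (\<lambda>x. x \<otimes> a)"
  by (intro smooth_map_mult charted smooth_map_id manifold smooth_map_constant)

lemma smooth_conjugation: "g \<in> carrier G \<Longrightarrow> smooth_map M M (\<lambda>x. g \<otimes> x \<otimes> inv g)"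
  by (intro smooth_map_mult charted smooth_map_id manifold smooth_map_constant inv_closed)

text \<open>Conjugation fixes the identity, so its differential preserves the tangent space there.\<close>

lemma Ad_closed:
  assumes "g \<in> carrier G" "X \<in> lie_algebra G M"
  shows "Ad G M g X \<in> lie_algebra G M"
  using differential_tangent[OF charted charted smooth_conjugation[OF assms(1)], of X \<one>] assms
  by (simp add: Ad_def lie_algebra_def)

lemma Ad_vec_add: "Ad G M g (vec_add X Y) = vec_add (Ad G M g X) (Ad G M g Y)"
  by (simp add: Ad_def differential_vec_add)

lemma Ad_mult:
  assumes "g \<in> carrier G" "h \<in> carrier G" "X \<in> lie_algebra G M"
  shows "Ad G M (g \<otimes> h) X = Ad G M g (Ad G M h X)"
  unfolding Ad_def differential_compose[OF charted charted smooth_conjugation[OF assms(1)]]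
proof (rule differential_cong[OF charted charted])
  show "smooth_map M M (\<lambda>x. g \<otimes> h \<otimes> x \<otimes> inv (g \<otimes> h))"
    using assms by (simp add: smooth_conjugation)
  show "\<one> \<in> topspace (mtop M)" by (simp flip: carrier_eq)
  show "X \<in> tangent_space M \<one>" using assms(3) by (simp add: lie_algebra_def)
  fix x assume "x \<in> topspace (mtop M)"
  then show "g \<otimes> h \<otimes> x \<otimes> inv (g \<otimes> h) = g \<otimes> (h \<otimes> x \<otimes> inv h) \<otimes> inv g"
    using assms by (simp add: m_assoc inv_mult_group flip: carrier_eq)
qed

lemma Ad_one:
  assumes "X \<in> lie_algebra G M"
  shows "Ad G M \<one> X = X"
proof -
  have X: "X \<in> tangent_space M \<one>" using assms by (simp add: lie_algebra_def)
  have "Ad G M \<one> X = differential M (\<lambda>x. x) X"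
    unfolding Ad_def
    by (rule differential_cong[OF charted charted smooth_conjugation _ X]) (auto simp flip: carrier_eq)
  then show ?thesis using differential_id[OF X] by simp
qed

lemma group_semidirect: "group (semidirect G M)"
proof (rule groupI)
  fix x y z assume "x \<in> carrier (semidirect G M)" "y \<in> carrier (semidirect G M)"
    "z \<in> carrier (semidirect G M)"
  then show "x \<otimes>\<^bsub>semidirect G M\<^esub> y \<otimes>\<^bsub>semidirect G M\<^esub> z =
      x \<otimes>\<^bsub>semidirect G M\<^esub> (y \<otimes>\<^bsub>semidirect G M\<^esub> z)"
    by (auto simp: semidirect_def m_assoc Ad_mult Ad_vec_add vec_add_assoc)
next
  fix x assume "x \<in> carrier (semidirect G M)"
  then obtain g X where x: "x = (g, X)" "g \<in> carrier G" "X \<in> lie_algebra G M"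
    by (auto simp: semidirect_def)
  have "vec_add (Ad G M (inv g) X) (Ad G M (inv g) (vec_scale (-1) X)) = vec_zero"
    unfolding Ad_def differential_vec_scale by (simp add: vec_add_def vec_scale_def vec_zero_def)
  moreover have "vec_scale (-1) X \<in> lie_algebra G M"
    using x(3) by (simp add: lie_algebra_def vec_scale_tangent)
  ultimately show "\<exists>y\<in>carrier (semidirect G M). y \<otimes>\<^bsub>semidirect G M\<^esub> x = \<one>\<^bsub>semidirect G M\<^esub>"
    \<comment> \<open>Solving \<open>Ad (inv g) X + Y = 0\<close> for the second component \<open>Y\<close> of the inverse.\<close>
    using x by (intro bexI[of _ "(inv g, Ad G M (inv g) (vec_scale (-1) X))"])
      (auto simp: semidirect_def Ad_closed)
qed (auto simp: semidirect_def Ad_closed Ad_one vec_add_tangent vec_zero_tangent lie_algebra_def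
    intro!: vec_add_tangent Ad_closed[unfolded lie_algebra_def] Ad_one[unfolded lie_algebra_def],
    auto simp: vec_add_def vec_zero_def)

text \<open>
  The product rule on the group: a smooth function \<open>f\<close> makes \<open>f (\<gamma> s \<otimes> \<delta> u)\<close> a smooth function of
  \<open>(s, u)\<close> on the plane, to which \<open>deriv_diagonal\<close> applies.
\<close>

lemma velocity_mult:
  assumes \<gamma>: "smooth_map real_line M \<gamma>" and \<delta>: "smooth_map real_line M \<delta>"
  shows "velocity M (\<lambda>s. \<gamma> s \<otimes> \<delta> s) t =
    vec_add (velocity M (\<lambda>s. \<gamma> s \<otimes> \<delta> t) t) (velocity M (\<lambda>s. \<gamma> t \<otimes> \<delta> s) t)"
proof
  fix f
  have "smooth_map plane M (\<lambda>z. \<gamma> (fst z) \<otimes> \<delta> (snd z))"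
    by (intro smooth_map_mult charted_plane
        smooth_map_compose[OF charted_plane charted_real_line charted smooth_map_fst_plane \<gamma>]
        smooth_map_compose[OF charted_plane charted_real_line charted smooth_map_snd_plane \<delta>])
  then have "smooth_map plane real_line (f \<circ> (\<lambda>z. \<gamma> (fst z) \<otimes> \<delta> (snd z)))" if "f \<in> smooth_funs M"
    using smooth_funs_compose[OF charted_plane charted] that unfolding smooth_funs_def by blast
  from deriv_diagonal[OF this, of t]
  show "velocity M (\<lambda>s. \<gamma> s \<otimes> \<delta> s) t f =
      vec_add (velocity M (\<lambda>s. \<gamma> s \<otimes> \<delta> t) t) (velocity M (\<lambda>s. \<gamma> t \<otimes> \<delta> s) t) f"
    by (simp add: velocity_def vec_add_def)
qed

text \<open>
  The right logarithmic derivative is a crossed homomorphism with respect to the adjoint action: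
  after translation by \<open>(\<gamma> \<delta>)\<^sup>-\<^sup>1 = \<delta>\<^sup>-\<^sup>1 \<gamma>\<^sup>-\<^sup>1\<close>, the factor \<open>\<delta> \<delta>\<^sup>-\<^sup>1\<close> cancels in the
  first term \<open>\<gamma>' \<delta>\<close> of the product rule, and the second term \<open>\<gamma> \<delta>'\<close> becomes the conjugate of
  \<open>\<delta>' \<delta>\<^sup>-\<^sup>1\<close> by \<open>\<gamma>\<close>.
\<close>

lemma log_velocity_mult:
  assumes \<gamma>: "smooth_map real_line M \<gamma>" and \<delta>: "smooth_map real_line M \<delta>"
  shows "differential M (\<lambda>x. x \<otimes> inv (\<gamma> t \<otimes> \<delta> t)) (velocity M (\<lambda>s. \<gamma> s \<otimes> \<delta> s) t) =
    vec_add (Ad G M (\<gamma> t) (differential M (\<lambda>x. x \<otimes> inv \<delta> t) (velocity M \<delta> t)))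
      (differential M (\<lambda>x. x \<otimes> inv \<gamma> t) (velocity M \<gamma> t))"
proof -
  have c: "\<gamma> s \<in> carrier G" "\<delta> s \<in> carrier G" for s
    using smooth_map_carrier[OF \<gamma>] smooth_map_carrier[OF \<delta>] by (simp_all add: real_line_def)
  note dv = differential_velocity[OF charted charted smooth_right_translation]
  have "differential M (\<lambda>x. x \<otimes> inv (\<gamma> t \<otimes> \<delta> t)) (velocity M (\<lambda>s. \<gamma> s \<otimes> \<delta> s) t) =
      vec_add (velocity M (\<lambda>s. \<gamma> s \<otimes> \<delta> t \<otimes> inv (\<gamma> t \<otimes> \<delta> t)) t)
        (velocity M (\<lambda>s. \<gamma> t \<otimes> \<delta> s \<otimes> inv (\<gamma> t \<otimes> \<delta> t)) t)"
    using c by (simp add: velocity_mult[OF \<gamma> \<delta>] differential_vec_add dv)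
  also have "(\<lambda>s. \<gamma> s \<otimes> \<delta> t \<otimes> inv (\<gamma> t \<otimes> \<delta> t)) = (\<lambda>s. \<gamma> s \<otimes> inv \<gamma> t)"
  proof -
    have "\<delta> t \<otimes> (inv \<delta> t \<otimes> inv \<gamma> t) = inv \<gamma> t"
      using c by (simp flip: m_assoc)
    then show ?thesis
      using c by (simp add: inv_mult_group m_assoc)
  qed
  also have "(\<lambda>s. \<gamma> t \<otimes> \<delta> s \<otimes> inv (\<gamma> t \<otimes> \<delta> t)) = (\<lambda>s. \<gamma> t \<otimes> (\<delta> s \<otimes> inv \<delta> t) \<otimes> inv \<gamma> t)"
    using c by (simp add: inv_mult_group m_assoc)
  also have "velocity M (\<lambda>s. \<gamma> t \<otimes> (\<delta> s \<otimes> inv \<delta> t) \<otimes> inv \<gamma> t) t =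
      Ad G M (\<gamma> t) (differential M (\<lambda>x. x \<otimes> inv \<delta> t) (velocity M \<delta> t))"
    using c by (simp add: Ad_def dv differential_velocity[OF charted charted smooth_conjugation])
  also have "velocity M (\<lambda>s. \<gamma> s \<otimes> inv \<gamma> t) t =
      differential M (\<lambda>x. x \<otimes> inv \<gamma> t) (velocity M \<gamma> t)"
    using c by (simp add: dv)
  finally show ?thesis by (simp add: vec_add_def add.commute)
qed

lemma log_velocity_closed:
  assumes "smooth_map real_line M \<gamma>"
  shows "differential M (\<lambda>x. x \<otimes> inv \<gamma> t) (velocity M \<gamma> t) \<in> lie_algebra G M"
proof -
  have c: "\<gamma> t \<in> carrier G"
    using smooth_map_carrier[OF assms] by (simp add: real_line_def)
  then show ?thesis
    using differential_tangent[OF charted charted smooth_right_translation[OF inv_closed]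
        velocity_tangent[OF charted assms], of "\<gamma> t" t]
    by (simp add: lie_algebra_def)
qed

end

section \<open>Twisted loops\<close>

lemma twisted_loopD:
  assumes "F \<in> carrier (twisted_loop_group G M \<tau> k)"
  shows "F \<in> sphere 0 1 \<rightarrow>\<^sub>E carrier G" "smooth_map real_line M (\<lambda>t. F (cis t))"
    and "z \<in> sphere 0 1 \<Longrightarrow> F (exp (2 * complex_of_real pi * \<i> / of_nat k) * z) = \<tau> (F z)"
  using assms by (auto simp: twisted_loop_group_def)

lemma root_of_unity_rotation:
  "z \<in> sphere 0 1 \<Longrightarrow> exp (2 * complex_of_real pi * \<i> / of_nat k) * z \<in> sphere 0 1"
  by (simp add: norm_mult norm_exp_eq_Re)

text \<open>
  Pointwise products and inverses stay smooth because the group operations are smooth maps, and stay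
  equivariant because \<open>\<tau>\<close> respects the group operations.
\<close>

lemma (in lie_group) group_twisted_loop_group:
  assumes "\<tau> \<in> hom G G"
  shows "group (twisted_loop_group G M \<tau> k)"
proof -
  interpret \<tau>: group_hom G G \<tau>
    using assms by unfold_locales
  let ?L = "twisted_loop_group G M \<tau> k"
  have loopI: "F \<in> carrier ?L" if "F \<in> sphere 0 1 \<rightarrow>\<^sub>E carrier G"
    "smooth_map real_line M (\<lambda>t. F (cis t))"
    "\<And>z. z \<in> sphere 0 1 \<Longrightarrow> F (exp (2 * complex_of_real pi * \<i> / of_nat k) * z) = \<tau> (F z)" for F
    using that by (auto simp: twisted_loop_group_def)
  have val: "F z \<in> carrier G" if "F \<in> carrier ?L" "z \<in> sphere 0 1" for F z
    using twisted_loopD(1)[OF that(1)] that(2) by blast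
  have mult: "F \<otimes>\<^bsub>?L\<^esub> H = (\<lambda>z\<in>sphere 0 1. F z \<otimes> H z)" for F H
    by (simp add: twisted_loop_group_def)
  have one: "\<one>\<^bsub>?L\<^esub> = (\<lambda>z\<in>sphere 0 1. \<one>)"
    by (simp add: twisted_loop_group_def)
  show ?thesis
  proof (rule groupI)
    fix F H assume F: "F \<in> carrier ?L" and H: "H \<in> carrier ?L"
    show "F \<otimes>\<^bsub>?L\<^esub> H \<in> carrier ?L"
      unfolding mult
    proof (rule loopI)
      show "smooth_map real_line M (\<lambda>t. (\<lambda>z\<in>sphere 0 1. F z \<otimes> H z) (cis t))"
        using smooth_map_mult[OF charted_real_line twisted_loopD(2)[OF F] twisted_loopD(2)[OF H]]
        by simp
    qed (use val[OF F] val[OF H] twisted_loopD(3)[OF F] twisted_loopD(3)[OF H]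
          root_of_unity_rotation in \<open>auto simp del: mem_sphere_0 mem_sphere\<close>)
  next
    show "\<one>\<^bsub>?L\<^esub> \<in> carrier ?L"
      unfolding one
    proof (rule loopI)
      show "smooth_map real_line M (\<lambda>t. (\<lambda>z\<in>sphere 0 1. \<one>) (cis t))"
        using smooth_map_constant[OF charted_real_line one_closed] by simp
    qed (use root_of_unity_rotation in \<open>auto simp del: mem_sphere_0 mem_sphere\<close>)
  next
    fix F H K assume "F \<in> carrier ?L" "H \<in> carrier ?L" "K \<in> carrier ?L"
    then show "F \<otimes>\<^bsub>?L\<^esub> H \<otimes>\<^bsub>?L\<^esub> K = F \<otimes>\<^bsub>?L\<^esub> (H \<otimes>\<^bsub>?L\<^esub> K)"
      using val unfolding mult by (intro restrict_ext) (simp add: m_assoc del: mem_sphere_0 mem_sphere)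
  next
    fix F assume F: "F \<in> carrier ?L"
    show "\<one>\<^bsub>?L\<^esub> \<otimes>\<^bsub>?L\<^esub> F = F"
      unfolding mult one using val[OF F] PiE_arb[OF twisted_loopD(1)[OF F]]
      by (auto simp: restrict_def fun_eq_iff)
    let ?K = "\<lambda>z\<in>sphere 0 1. inv F z"
    have "?K \<in> carrier ?L"
    proof (rule loopI)
      show "smooth_map real_line M (\<lambda>t. ?K (cis t))"
        using smooth_map_inv[OF charted_real_line twisted_loopD(2)[OF F]] by simp
    qed (use val[OF F] twisted_loopD(3)[OF F] root_of_unity_rotation
          in \<open>auto simp del: mem_sphere_0 mem_sphere\<close>)
    moreover have "?K \<otimes>\<^bsub>?L\<^esub> F = \<one>\<^bsub>?L\<^esub>"
      unfolding mult one using val[OF F] by (intro restrict_ext) auto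
    ultimately show "\<exists>K\<in>carrier ?L. K \<otimes>\<^bsub>?L\<^esub> F = \<one>\<^bsub>?L\<^esub>" by blast
  qed
qed

theorem proposition3p1:
  fixes G :: "('g, 'b) monoid_scheme"
    and M :: "('g, 'e::real_inner) manifold"
    and \<tau> :: "'g \<Rightarrow> 'g" and k :: nat and \<mu> :: complex
  assumes "lie_group G M"
    and "compact_space (mtop M)"
    and "semisimple G M"
    and "\<tau> \<in> lie_auto G M"
    and "k \<ge> 2"
    and "group.ord (AutoGroup G) \<tau> = k"
    and "\<mu> \<in> sphere 0 1"
  shows "group_hom (twisted_loop_group G M \<tau> k) (semidirect G M) (Phi G M \<mu>)"
proof -
  interpret lie_group G M by fact
  let ?L = "twisted_loop_group G M \<tau> k"
  have "\<tau> \<in> hom G G"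
    using assms(4) by (simp add: lie_auto_def auto_def)
  then have L: "group ?L"
    by (rule group_twisted_loop_group)
  have \<mu>: "cis (Arg \<mu>) = \<mu>"
    using assms(7) by (subst cis_Arg) (auto simp: sgn_div_norm)
  have closed: "Phi G M \<mu> F \<in> carrier (semidirect G M)" if F: "F \<in> carrier ?L" for F
    using log_velocity_closed[OF twisted_loopD(2)[OF F], of "Arg \<mu>"] twisted_loopD(1)[OF F] assms(7)
    unfolding \<mu> by (auto simp: Phi_def right_log_deriv_def semidirect_def)
  have "Phi G M \<mu> (F \<otimes>\<^bsub>?L\<^esub> H) = Phi G M \<mu> F \<otimes>\<^bsub>semidirect G M\<^esub> Phi G M \<mu> H"
    if F: "F \<in> carrier ?L" and H: "H \<in> carrier ?L" for F H
  proof -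
    have "F \<otimes>\<^bsub>?L\<^esub> H = (\<lambda>z\<in>sphere 0 1. F z \<otimes>\<^bsub>G\<^esub> H z)"
      by (simp add: twisted_loop_group_def)
    then have "(F \<otimes>\<^bsub>?L\<^esub> H) \<mu> = F \<mu> \<otimes>\<^bsub>G\<^esub> H \<mu>"
      "(\<lambda>t. (F \<otimes>\<^bsub>?L\<^esub> H) (cis t)) = (\<lambda>t. F (cis t) \<otimes>\<^bsub>G\<^esub> H (cis t))"
      using assms(7) by auto
    then show ?thesis
      using log_velocity_mult[OF twisted_loopD(2)[OF F] twisted_loopD(2)[OF H], of "Arg \<mu>"]
      unfolding \<mu> by (simp add: Phi_def right_log_deriv_def semidirect_def)
  qed
  with closed have "Phi G M \<mu> \<in> hom ?L (semidirect G M)"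
    by (auto intro!: homI)
  then show ?thesis
    using L group_semidirect by (simp add: group_hom_def group_hom_axioms_def)
qed

end
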